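(* The diameter of the $1$-skeleton of $SATP(m,n)$ equals $2$. The clique number of the $1$-skeleton of $SATP(m,n)$ is superpolynomial in dimension and bounded from below by $2^{\min\{m,n\}}$.
   Context: For positive integers $m,n$, points of $\mathbb{R}^{6mn}$ have coordinates $x^{k,l}_{i,j}$ with $k\in\{1,2,3\}$, $l\in\{1,2\}$, $i\in\{1,\dots,m\}$, $j\in\{1,\dots,n\}$. $SATP(m,n)\subset\mathbb{R}^{6mn}$ is the polytope obtained as the convex hull of all integral solutions of the system $$\sum_{k,l}x^{k,l}_{i,j}=1,\qquad x^{1,1}_{i,j}+x^{2,1}_{i,j}+x^{3,1}_{i,j}=x^{1,1}_{i,t}+x^{2,1}_{i,t}+x^{3,1}_{i,t},\qquad x^{k,1}_{i,j}+x^{k,2}_{i,j}=x^{k,1}_{s,j}+x^{k,2}_{s,j},\qquad x^{k,l}_{i,j}\ge 0,$$ for all $k\in\{1,2,3\}$, $l\in\{1,2\}$, $i,s\in\{1,\dots,m\}$, $j,t\in\{1,\dots,n\}$. The 1-skeleton of a polytope is the graph formed by its vertices ($0$-faces) and its edges ($1$-faces). The diameter of a graph is the largest distance between two of its vertices, and its clique number is the largest size of a set of pairwise adjacent vertices.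
   Formalization: Diameter 2 is claimed except for m=n=1, where the polytope is a 5-simplex of diameter 1; "superpolynomial in dimension" is taken as min{m,n} grows with max{m,n} at most a fixed power of min{m,n}, since for fixed m the clique number is at most 3·2^m. *)

theory Defs
  imports
    "HOL-Analysis.Analysis"
    "HOL-Analysis.Finite_Function_Topology"
    "HOL-Computational_Algebra.Polynomial"
    "HOL-Library.Ramsey"
begin

text \<open>
  The dimension of the ambient space depends on two natural numbers that are quantified inside the
  theorem, so it cannot be fixed by a type. All polytopes therefore live in the real vector space of
  finitely supported functions from index quadruples \<open>(k, l, i, j)\<close> to the reals, and
  \<open>satp_space m n\<close> is the copy of $\mathbb{R}^{6mn}$ spanned by the admissible indices. The notions
  \<open>convex hull\<close>, \<open>face_of\<close> and \<open>extreme_point_of\<close> are the ones of the library and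
  do not depend on the ambient space.
\<close>

type_synonym satp_vec = "(nat \<times> nat \<times> nat \<times> nat) \<Rightarrow>\<^sub>0 real"

definition satp_space :: "nat \<Rightarrow> nat \<Rightarrow> satp_vec set" where
  "satp_space m n = {x. Poly_Mapping.keys x \<subseteq> {1..3} \<times> {1..2} \<times> {1..m} \<times> {1..n}}"

definition satp_system :: "nat \<Rightarrow> nat \<Rightarrow> satp_vec set" where
  "satp_system m n = {x \<in> satp_space m n.
     let X = (\<lambda>k l i j. Poly_Mapping.lookup x (k, l, i, j)) in
       (\<forall>i\<in>{1..m}. \<forall>j\<in>{1..n}. (\<Sum>k=1..3. \<Sum>l=1..2. X k l i j) = 1) \<and>
       (\<forall>i\<in>{1..m}. \<forall>j\<in>{1..n}. \<forall>t\<in>{1..n}.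
          X 1 1 i j + X 2 1 i j + X 3 1 i j = X 1 1 i t + X 2 1 i t + X 3 1 i t) \<and>
       (\<forall>k\<in>{1..3}. \<forall>i\<in>{1..m}. \<forall>s\<in>{1..m}. \<forall>j\<in>{1..n}.
          X k 1 i j + X k 2 i j = X k 1 s j + X k 2 s j) \<and>
       (\<forall>k\<in>{1..3}. \<forall>l\<in>{1..2}. \<forall>i\<in>{1..m}. \<forall>j\<in>{1..n}. X k l i j \<ge> 0)}"

definition SATP :: "nat \<Rightarrow> nat \<Rightarrow> satp_vec set" where
  "SATP m n = convex hull {x \<in> satp_system m n. \<forall>a. Poly_Mapping.lookup x a \<in> \<int>}"

text \<open>
  Affine dimension: the dimension of the linear space parallel to the affine hull. The library's
  \<open>aff_dim\<close> is only available on Euclidean spaces, where it agrees with this on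
  nonempty sets (the empty set gets \<open>0\<close> here, not \<open>-1\<close>).
\<close>

definition affine_dimension :: "'a::real_vector set \<Rightarrow> nat" where
  "affine_dimension S = dim {x - y | x y. x \<in> S \<and> y \<in> S}"

definition skeleton_verts :: "'a::real_vector set \<Rightarrow> 'a set" where
  "skeleton_verts P = {v. v extreme_point_of P}"

definition skeleton_edges :: "'a::real_vector set \<Rightarrow> 'a set set" where
  "skeleton_edges P = {{u, v} | u v. u \<in> skeleton_verts P \<and> v \<in> skeleton_verts P \<and> u \<noteq> v \<and>
     (\<exists>e. e face_of P \<and> affine_dimension e = 1 \<and> u \<in> e \<and> v \<in> e)}"

text \<open>
  Distances take the value \<open>\<infinity>\<close> between different components; pairs in the
  \<open>n\<close>-th relation power of adjacency are the pairs joined by a walk of length \<open>n\<close>.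
\<close>

definition graph_distance :: "'a set set \<Rightarrow> 'a \<Rightarrow> 'a \<Rightarrow> enat" where
  "graph_distance E u v = (INF n\<in>{n. (u, v) \<in> {(a, b). {a, b} \<in> E} ^^ n}. enat n)"

definition graph_diameter :: "'a set \<Rightarrow> 'a set set \<Rightarrow> enat" where
  "graph_diameter V E = (SUP u\<in>V. SUP v\<in>V. graph_distance E u v)"

definition clique_number :: "'a set \<Rightarrow> 'a set set \<Rightarrow> nat" where
  "clique_number V E = Max {card K | K. K \<subseteq> V \<and> finite K \<and> clique K E}"

definition skeleton_diameter :: "'a::real_vector set \<Rightarrow> enat" where
  "skeleton_diameter P = graph_diameter (skeleton_verts P) (skeleton_edges P)"

definition skeleton_clique_number :: "'a::real_vector set \<Rightarrow> nat" where
  "skeleton_clique_number P = clique_number (skeleton_verts P) (skeleton_edges P)"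

text \<open>
  A two-parameter family of polytopes has clique number superpolynomial in the dimension if it
  eventually exceeds every polynomial in the dimension as both parameters grow. The parameters have
  to stay polynomially related (in particular \<open>m = n\<close> is covered): the clique number of
  \<open>SATP m n\<close> is at most $3 \cdot 2^m$ for every \<open>n\<close>, while its dimension is at least \<open>mn\<close>.
\<close>

definition superpolynomial_clique_number :: "(nat \<Rightarrow> nat \<Rightarrow> 'a::real_vector set) \<Rightarrow> bool" where
  "superpolynomial_clique_number P \<longleftrightarrow>
     (\<forall>(p :: real poly) (r :: nat). \<exists>N. \<forall>m n. N \<le> min m n \<and> max m n \<le> min m n ^ r \<longrightarrow>
        real (skeleton_clique_number (P m n)) > poly p (real (affine_dimension (P m n))))"

end

theory Submission
  imports Defs
begin

text \<open>
  An integral solution is given by a label \<open>l = r i\<close> for every row and a label \<open>k = c j\<close> for every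
  column, so the vertices are the \<open>2 ^ m * 3 ^ n\<close> points \<open>(r, c)\<close>. If \<open>r \<noteq> r'\<close> and \<open>c \<noteq> c'\<close>, then
  no third vertex is supported on the union of the supports of \<open>(r, c)\<close> and \<open>(r', c')\<close>; setting the
  remaining coordinates to zero cuts out a face, which is therefore an edge. Hence two vertices
  have a common neighbour, except for \<open>m = 1\<close> and \<open>r \<noteq> r'\<close>, when they are adjacent; and
  pairing distinct row labellings with distinct column labellings gives a clique of size
  \<open>min (2 ^ m) (3 ^ n)\<close>. Two vertices that differ only in several rows, or only in several columns,
  are not adjacent: swapping one of the labels gives another pair of vertices with the same midpoint.
\<close>

subsection \<open>Faces and edges of polytopes with nonnegative vertices\<close>

text \<open>A convex combination with positive weight on a generator where \<open>f\<close> is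
  positive has positive value, so only the generators with \<open>f v = 0\<close> contribute to
  points where \<open>f\<close> vanishes. As \<open>f\<close> is minimal there, a segment through
  such a point stays in the zero set.\<close>

lemma face_of_convex_hull_zero_set:
  fixes f :: "'a::real_vector \<Rightarrow> real"
  assumes f: "linear f" and nonneg: "\<And>v. v \<in> V \<Longrightarrow> 0 \<le> f v"
  shows "convex hull {v \<in> V. f v = 0} face_of convex hull V"
proof -
  define H where "H = convex hull {v \<in> V. f v = 0}"
  define T where "T = {x. 0 < f x} \<union> H"
  have lin: "f (u *\<^sub>R x + w *\<^sub>R y) = u * f x + w * f y" for u w x y
    by (simp add: linear_add[OF f] linear_scale[OF f])
  have "convex {x. f x = 0}"
    by (rule convexI) (simp add: lin)
  then have H0: "f x = 0" if "x \<in> H" for x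
    using that hull_minimal[of "{v \<in> V. f v = 0}" "{x. f x = 0}" convex] by (auto simp: H_def)
  \<comment> \<open>By minimality of the hull, it suffices that the convex set \<open>T\<close> contains \<open>V\<close>.\<close>
  have "convex T"
  proof (rule convexI)
    fix x y and u w :: real
    assume xy: "x \<in> T" "y \<in> T" and uw: "0 \<le> u" "0 \<le> w" "u + w = 1"
    show "u *\<^sub>R x + w *\<^sub>R y \<in> T"
    proof (cases "u = 0 \<or> w = 0 \<or> (x \<in> H \<and> y \<in> H)")
      case True
      then consider "u = 0" | "w = 0" | "x \<in> H" "y \<in> H"
        by blast
      then show ?thesis
      proof cases
        case 3
        have "convex H"
          by (simp add: H_def)
        then have "u *\<^sub>R x + w *\<^sub>R y \<in> H"
          using 3 uw by (rule convexD)
        then show ?thesis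
          by (simp add: T_def)
      qed (use xy uw in simp_all)
    next
      case False
      then have "0 < u" "0 < w" "0 < f x \<or> 0 < f y" "0 \<le> f x" "0 \<le> f y"
        using xy uw H0 by (auto simp: T_def)
      then have "0 < u * f x + w * f y"
        by (auto intro: add_pos_nonneg add_nonneg_pos)
      then show ?thesis
        by (simp add: T_def lin)
    qed
  qed
  moreover have "V \<subseteq> T"
    using nonneg by (force simp: T_def H_def intro: hull_inc)
  ultimately have sub: "convex hull V \<subseteq> T"
    by (rule hull_minimal[rotated])
  have "a \<in> H \<and> b \<in> H"
    if a: "a \<in> convex hull V" and b: "b \<in> convex hull V" and x: "x \<in> H" "x \<in> open_segment a b"
    for a b x
  proof -
    obtain u where u: "0 < u" "u < 1" "x = (1 - u) *\<^sub>R a + u *\<^sub>R b"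
      using x(2) by (auto simp: in_segment)
    have ge: "0 \<le> f a" "0 \<le> f b"
      using a b sub H0 by (force simp: T_def)+
    have "(1 - u) * f a + u * f b = 0"
      using H0[OF x(1)] u(3) by (simp add: lin)
    moreover have "0 \<le> (1 - u) * f a" "0 \<le> u * f b"
      using u ge by auto
    ultimately have "(1 - u) * f a = 0" "u * f b = 0"
      by linarith+
    then have "f a = 0" "f b = 0"
      using u by auto
    then show ?thesis
      using a b sub by (auto simp: T_def)
  qed
  moreover have "H \<subseteq> convex hull V" "convex H"
    unfolding H_def by (intro hull_mono convex_convex_hull; blast)+
  ultimately show ?thesis
    unfolding face_of_def H_def[symmetric] by blast
qed

lemma lookup_scaleR [simp]:
  "Poly_Mapping.lookup (c *\<^sub>R x) a = c *\<^sub>R Poly_Mapping.lookup x a"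
proof -
  have "finite {i. c *\<^sub>R Poly_Mapping.lookup x i \<noteq> 0}"
    by (rule finite_subset[of _ "Poly_Mapping.keys x"]) (auto simp: in_keys_iff)
  then show ?thesis
    by (simp add: scaleR_poly_mapping_def)
qed

lemma linear_sum_lookup:
  "linear (\<lambda>x :: 'a \<Rightarrow>\<^sub>0 real. \<Sum>a\<in>A. Poly_Mapping.lookup x a)"
  by (rule linearI) (simp_all add: lookup_add sum.distrib sum_distrib_left)

text \<open>The sum of the coordinates in \<open>I - J\<close> is linear, nonnegative on
  \<open>V\<close>, and zero exactly on the points supported in \<open>J\<close>, so it exposes this
  face. Below, \<open>J\<close> is the support of one vertex or the union of two supports.\<close>

lemma support_face:
  fixes V :: "('a \<Rightarrow>\<^sub>0 real) set"
  assumes "finite I" and keys: "\<And>v. v \<in> V \<Longrightarrow> Poly_Mapping.keys v \<subseteq> I"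
    and nonneg: "\<And>v a. v \<in> V \<Longrightarrow> 0 \<le> Poly_Mapping.lookup v a"
  shows "convex hull {v \<in> V. Poly_Mapping.keys v \<subseteq> J} face_of convex hull V"
proof -
  have "(\<Sum>a\<in>I - J. Poly_Mapping.lookup v a) = 0 \<longleftrightarrow> Poly_Mapping.keys v \<subseteq> J" if "v \<in> V" for v
    using that keys[OF that] \<open>finite I\<close>
    by (subst sum_nonneg_eq_0_iff) (auto simp: nonneg in_keys_iff)
  then have "{v \<in> V. Poly_Mapping.keys v \<subseteq> J}
      = {v \<in> V. (\<Sum>a\<in>I - J. Poly_Mapping.lookup v a) = 0}"
    by blast
  then show ?thesis
    using face_of_convex_hull_zero_set[OF linear_sum_lookup, of V "I - J"]
    by (simp add: nonneg sum_nonneg)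
qed

section \<open>One-dimensional sets and edges of the skeleton\<close>

lemma affine_dimension_segment:
  fixes u v :: "'a::real_vector"
  assumes "u \<noteq> v"
  shows "affine_dimension (convex hull {u, v}) = 1"
proof -
  let ?D = "{x - y | x y. x \<in> convex hull {u, v} \<and> y \<in> convex hull {u, v}}"
  have "?D \<subseteq> span {v - u}"
  proof clarify
    fix x y assume "x \<in> convex hull {u, v}" "y \<in> convex hull {u, v}"
    then obtain s t where "x = (1 - s) *\<^sub>R u + s *\<^sub>R v" "y = (1 - t) *\<^sub>R u + t *\<^sub>R v"
      by (auto simp flip: segment_convex_hull simp: in_segment)
    then have "x - y = (s - t) *\<^sub>R (v - u)"
      by (simp add: scaleR_diff_left scaleR_diff_right)
    then show "x - y \<in> span {v - u}"
      by (simp add: span_base span_scale)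
  qed
  moreover have "v - u \<in> ?D"
    using hull_inc[of u "{u, v}"] hull_inc[of v "{u, v}"] by blast
  ultimately have "span {v - u} = span ?D"
    by (intro antisym span_minimal) (auto intro: span_base)
  moreover have "independent {v - u}"
    using assms by (auto simp: dependent_single)
  ultimately have "dim ?D = card {v - u}"
    by (intro dim_eq_card)
  then show ?thesis
    by (simp add: affine_dimension_def)
qed

text \<open>All differences of points of \<open>e\<close> lie on the line spanned by one basis
  vector, and \<open>v - u\<close>, being nonzero, spans the same line.\<close>

lemma affine_dimension_1_collinear:
  fixes u v w :: "'a::real_vector"
  assumes "affine_dimension e = 1" "u \<in> e" "v \<in> e" "w \<in> e" "u \<noteq> v"
  obtains c where "w - u = c *\<^sub>R (v - u)"
proof -
  let ?D = "{x - y | x y. x \<in> e \<and> y \<in> e}"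
  obtain B where B: "B \<subseteq> ?D" "independent B" "?D \<subseteq> span B" "card B = dim ?D"
    by (rule basis_exists)
  then obtain b where b: "B = {b}"
    using assms(1) by (auto simp: affine_dimension_def card_1_singleton_iff)
  have "w - u \<in> span {b}" "v - u \<in> span {b}"
    using B(3) assms(2-4) unfolding b by blast+
  then obtain s t where st: "w - u = s *\<^sub>R b" "v - u = t *\<^sub>R b"
    unfolding span_singleton by (elim rangeE)
  then have "t \<noteq> 0"
    using assms(5) by auto
  then have "w - u = (s / t) *\<^sub>R (v - u)"
    unfolding st by simp
  then show ?thesis
    by (rule that)
qed

lemma skeleton_edgesI:
  assumes "u \<noteq> v" "convex hull {u, v} face_of P"
    "u \<in> skeleton_verts P" "v \<in> skeleton_verts P"
  shows "{u, v} \<in> skeleton_edges P"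
proof -
  have "u \<in> convex hull {u, v}" "v \<in> convex hull {u, v}"
    by (simp_all add: hull_inc)
  then show ?thesis
    unfolding skeleton_edges_def mem_Collect_eq using assms affine_dimension_segment[OF assms(1)]
    by (intro exI[of _ u] exI[of _ v] exI[of _ "convex hull {u, v}"] conjI refl)
qed

text \<open>Both pairs have the same midpoint, so a face containing \<open>u\<close> and
  \<open>v\<close> also contains \<open>w\<close>. The line through two 0/1 points carries no third
  one, so that face is not one-dimensional.\<close>

lemma not_skeleton_edge:
  fixes V :: "('a \<Rightarrow>\<^sub>0 real) set"
  assumes V01: "\<And>v a. v \<in> V \<Longrightarrow> Poly_Mapping.lookup v a \<in> {0, 1}"
    and V: "u \<in> V" "v \<in> V" "w \<in> V" "w' \<in> V"
    and uvw: "u \<noteq> v" "w \<noteq> u" "w \<noteq> v" "u + v = w + w'"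
  shows "{u, v} \<notin> skeleton_edges (convex hull V)"
proof
  assume "{u, v} \<in> skeleton_edges (convex hull V)"
  then obtain e where e: "e face_of convex hull V" "affine_dimension e = 1" "u \<in> e" "v \<in> e"
    unfolding skeleton_edges_def by (auto simp: doubleton_eq_iff)
  \<comment> \<open>At a coordinate separating \<open>u\<close> from \<open>v\<close> their sum is
    1, so \<open>w\<close> and \<open>w'\<close> cannot coincide. The same coordinate later forces
    the parameter \<open>c\<close> of \<open>w\<close> on the line to be 0 or 1.\<close>
  obtain a where a: "Poly_Mapping.lookup u a \<noteq> Poly_Mapping.lookup v a"
    using uvw(1) by (metis poly_mapping_eqI)
  have "Poly_Mapping.lookup u a + Poly_Mapping.lookup v a
      = Poly_Mapping.lookup w a + Poly_Mapping.lookup w' a"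
    using uvw(4) by (metis lookup_add)
  then have "w \<noteq> w'"
    using a V01[OF V(1), of a] V01[OF V(2), of a] V01[OF V(3), of a] by auto
  then have "midpoint w w' \<in> open_segment w w'"
    by simp
  moreover have "midpoint w w' \<in> e"
  proof -
    have "midpoint w w' = midpoint u v"
      using uvw(4) by (simp add: midpoint_def)
    moreover have "convex e"
      using e(1) by (rule face_of_imp_convex)
    ultimately show ?thesis
      using e by (metis convex_contains_segment midpoint_in_closed_segment subsetD)
  qed
  ultimately have "w \<in> e"
    using face_ofD[OF e(1)] V by (meson hull_inc)
  then obtain c where c: "w - u = c *\<^sub>R (v - u)"
    using affine_dimension_1_collinear e uvw(1) by metis
  then have "Poly_Mapping.lookup w a - Poly_Mapping.lookup u a
      = c * (Poly_Mapping.lookup v a - Poly_Mapping.lookup u a)"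
    by (metis lookup_minus lookup_scaleR real_scaleR_def)
  then have "c = 0 \<or> c = 1"
    using a V01[OF V(1), of a] V01[OF V(2), of a] V01[OF V(3), of a] by auto
  then show False
    using c uvw by auto
qed

section \<open>Bounds on the graph distance\<close>

lemma graph_distance_le: "(u, v) \<in> {(a, b). {a, b} \<in> E} ^^ n \<Longrightarrow> graph_distance E u v \<le> enat n"
  unfolding graph_distance_def by (rule INF_lower) simp

lemma graph_distance_ge_2:
  assumes "u \<noteq> v" "{u, v} \<notin> E"
  shows "2 \<le> graph_distance E u v"
  unfolding graph_distance_def
proof (rule INF_greatest)
  fix n assume "n \<in> {n. (u, v) \<in> {(a, b). {a, b} \<in> E} ^^ n}"
  then have walk: "(u, v) \<in> {(a, b). {a, b} \<in> E} ^^ n"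
    by simp
  then have "n \<noteq> 0"
    using assms(1) by (intro notI) simp
  moreover have "n \<noteq> 1"
    using walk assms(2) by (intro notI) simp
  ultimately show "2 \<le> enat n"
    by (simp add: numeral_eq_enat)
qed

subsection \<open>Polynomial against exponential growth\<close>

text \<open>Unlike \<open>p\<close> itself, the bound is monotone in nonnegative \<open>x\<close>,
  so an upper estimate of the dimension can be substituted for \<open>x\<close>.\<close>

lemma poly_le_const_times_power:
  fixes p :: "real poly"
  assumes "0 \<le> x"
  shows "poly p x \<le> (\<Sum>i\<le>degree p. \<bar>coeff p i\<bar>) * (1 + x) ^ degree p"
proof -
  have "coeff p i * x ^ i \<le> \<bar>coeff p i\<bar> * (1 + x) ^ degree p" if "i \<le> degree p" for i
  proof -
    have "x ^ i \<le> (1 + x) ^ i" "(1 + x) ^ i \<le> (1 + x) ^ degree p"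
      using assms that by (auto intro: power_mono power_increasing)
    then have "x ^ i \<le> (1 + x) ^ degree p"
      by linarith
    then show ?thesis
      using assms by (intro mult_mono) auto
  qed
  then show ?thesis
    by (auto simp: poly_altdef sum_distrib_right intro!: sum_mono)
qed

text \<open>The left side is the preceding bound with \<open>6 * k ^ r\<close> for \<open>x\<close>,
  the form in which the dimension is estimated later.\<close>

lemma eventually_poly_less_exp:
  "\<forall>\<^sub>F k in sequentially. C * (1 + 6 * real k ^ r) ^ d < 2 ^ k"
proof -
  \<comment> \<open>For \<open>x = k * ln 2\<close>, \<open>exp x\<close> equals
    \<open>2 ^ k\<close>, so the limit of \<open>x ^ n / exp x\<close> applies.\<close>
  have "filterlim (\<lambda>k. real k * ln 2) at_top sequentially"
    by (rule filterlim_at_top_mult_tendsto_pos[OF tendsto_const _ filterlim_real_sequentially]) simp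
  then have "(\<lambda>k. (real k * ln 2) ^ (r * d) / exp (real k * ln 2)) \<longlonglongrightarrow> 0"
    by (rule filterlim_compose[OF tendsto_power_div_exp_0])
  \<comment> \<open>The factor cancels the powers of \<open>ln 2\<close> and brings in the constants
    needed below.\<close>
  then have "(\<lambda>k. (real k * ln 2) ^ (r * d) / exp (real k * ln 2)
      * (\<bar>C\<bar> * 7 ^ d / ln 2 ^ (r * d))) \<longlonglongrightarrow> 0"
    by (rule tendsto_mult_left_zero)
  then have "(\<lambda>k. (\<bar>C\<bar> * 7 ^ d) * (real k ^ (r * d) * (1 / 2) ^ k)) \<longlonglongrightarrow> 0"
    by (simp add: power_mult_distrib exp_of_nat_mult power_divide mult_ac)
  then have "\<forall>\<^sub>F k in sequentially. (\<bar>C\<bar> * 7 ^ d) * (real k ^ (r * d) * (1 / 2) ^ k) < 1"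
    by (rule order_tendstoD) simp
  then show ?thesis
    using eventually_ge_at_top[of 1]
  proof eventually_elim
    case (elim k)
    \<comment> \<open>The 7 below arises from \<open>1 + 6 * k ^ r \<le> 7 * k ^ r\<close>, which
      needs \<open>k \<ge> 1\<close>.\<close>
    have "1 \<le> real k ^ r"
      using elim by simp
    then have "(1 + 6 * real k ^ r) ^ d \<le> (7 * real k ^ r) ^ d"
      by (intro power_mono) auto
    then have "C * (1 + 6 * real k ^ r) ^ d \<le> \<bar>C\<bar> * (7 * real k ^ r) ^ d"
      by (intro mult_mono) auto
    also have "\<dots> = (\<bar>C\<bar> * 7 ^ d) * real k ^ (r * d)"
      by (simp add: power_mult_distrib power_mult)
    also have "\<dots> < 2 ^ k"
      using elim by (simp add: power_divide field_simps)
    finally show ?case .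
  qed
qed

subsection \<open>Vertices and edges of SATP\<close>

text \<open>Extensional functions: a labelling is determined by its values on \<open>{1..m}\<close>,
  which makes these sets finite and countable by \<open>card_PiE\<close>.\<close>

definition row_labels :: "nat \<Rightarrow> (nat \<Rightarrow> nat) set" where
  "row_labels m = {1..m} \<rightarrow>\<^sub>E {1..2}"

definition col_labels :: "nat \<Rightarrow> (nat \<Rightarrow> nat) set" where
  "col_labels n = {1..n} \<rightarrow>\<^sub>E {1..3}"

definition satp_point :: "nat \<Rightarrow> nat \<Rightarrow> (nat \<Rightarrow> nat) \<Rightarrow> (nat \<Rightarrow> nat) \<Rightarrow> satp_vec" where
  "satp_point m n r c = Abs_poly_mapping
     (\<lambda>(k, l, i, j). of_bool (i \<in> {1..m} \<and> j \<in> {1..n} \<and> k = c j \<and> l = r i))"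

definition satp_points :: "nat \<Rightarrow> nat \<Rightarrow> satp_vec set" where
  "satp_points m n = {satp_point m n r c | r c. r \<in> row_labels m \<and> c \<in> col_labels n}"

lemma lookup_satp_point [simp]:
  "Poly_Mapping.lookup (satp_point m n r c) (k, l, i, j)
    = of_bool (i \<in> {1..m} \<and> j \<in> {1..n} \<and> k = c j \<and> l = r i)"
proof -
  let ?f = "\<lambda>(k, l, i, j). of_bool (i \<in> {1..m} \<and> j \<in> {1..n} \<and> k = c j \<and> l = r i) :: real"
  \<comment> \<open>Each cell \<open>(i, j)\<close> carries one nonzero coordinate, so the support
    is an image of the grid.\<close>
  have "finite {a. ?f a \<noteq> 0}"
    by (rule finite_subset[of _ "(\<lambda>(i, j). (c j, r i, i, j)) ` ({1..m} \<times> {1..n})"])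
      (auto simp: image_iff)
  then show ?thesis
    unfolding satp_point_def by (subst lookup_Abs_poly_mapping) simp_all
qed

lemma in_keys_satp_point [simp]:
  "(k, l, i, j) \<in> Poly_Mapping.keys (satp_point m n r c)
    \<longleftrightarrow> i \<in> {1..m} \<and> j \<in> {1..n} \<and> k = c j \<and> l = r i"
  by (auto simp: in_keys_iff)

lemma satp_pointsI: "r \<in> row_labels m \<Longrightarrow> c \<in> col_labels n \<Longrightarrow> satp_point m n r c \<in> satp_points m n"
  unfolding satp_points_def by blast

lemma satp_pointsE:
  assumes "v \<in> satp_points m n"
  obtains r c where "r \<in> row_labels m" "c \<in> col_labels n" "v = satp_point m n r c"
  using assms unfolding satp_points_def by blast

lemma row_labels_eqI:
  "r \<in> row_labels m \<Longrightarrow> r' \<in> row_labels m \<Longrightarrow> (\<And>i. i \<in> {1..m} \<Longrightarrow> r i = r' i) \<Longrightarrow> r = r'"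
  unfolding row_labels_def by (rule PiE_ext)

lemma col_labels_eqI:
  "c \<in> col_labels n \<Longrightarrow> c' \<in> col_labels n \<Longrightarrow> (\<And>j. j \<in> {1..n} \<Longrightarrow> c j = c' j) \<Longrightarrow> c = c'"
  unfolding col_labels_def by (rule PiE_ext)

lemma row_labels_mem: "r \<in> row_labels m \<Longrightarrow> i \<in> {1..m} \<Longrightarrow> r i \<in> {1..2}"
  unfolding row_labels_def by (rule PiE_mem)

lemma col_labels_mem: "c \<in> col_labels n \<Longrightarrow> j \<in> {1..n} \<Longrightarrow> c j \<in> {1..3}"
  unfolding col_labels_def by (rule PiE_mem)

text \<open>Cell \<open>(i, 1)\<close> reveals \<open>r i\<close> and cell \<open>(1, j)\<close>
  reveals \<open>c j\<close>; the grid has to be nonempty for these cells to exist.\<close>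

lemma satp_point_eq_iff:
  assumes "1 \<le> m" "1 \<le> n" "r \<in> row_labels m" "r' \<in> row_labels m" "c \<in> col_labels n" "c' \<in> col_labels n"
  shows "satp_point m n r c = satp_point m n r' c' \<longleftrightarrow> r = r' \<and> c = c'"
proof
  assume eq: "satp_point m n r c = satp_point m n r' c'"
  have *: "c' j = c j \<and> r' i = r i" if "i \<in> {1..m}" "j \<in> {1..n}" for i j
    using arg_cong[OF eq, of "\<lambda>x. Poly_Mapping.lookup x (c j, r i, i, j)"] that
    by (auto split: if_splits simp: of_bool_def)
  have "r i = r' i" if "i \<in> {1..m}" for i
    using *[of i 1] that assms by auto
  moreover have "c j = c' j" if "j \<in> {1..n}" for j
    using *[of 1 j] that assms by auto
  ultimately show "r = r' \<and> c = c'"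
    using row_labels_eqI[OF assms(3,4)] col_labels_eqI[OF assms(5,6)] by blast
qed auto

section \<open>Integral solutions of the system\<close>

lemma sum_1_3: "(\<Sum>k=1..3. f k) = f 1 + f 2 + f (3::nat)" for f :: "nat \<Rightarrow> real"
  by (simp add: numeral_eq_Suc)

lemma sum_1_2: "(\<Sum>l=1..2. f l) = f 1 + f (2::nat)" for f :: "nat \<Rightarrow> real"
  by (simp add: numeral_eq_Suc)

lemma atLeastAtMost_1_3: "{1..3::nat} = {1, 2, 3}"
  by auto

lemma atLeastAtMost_1_2: "{1..2::nat} = {1, 2}"
  by auto

lemma satp_point_in_system:
  assumes r: "r \<in> row_labels m" and c: "c \<in> col_labels n"
  shows "satp_point m n r c \<in> satp_system m n"
proof -
  have r': "r i = 1 \<or> r i = 2" if "i \<in> {1..m}" for i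
    using row_labels_mem[OF r that] by auto
  have c': "c j = 1 \<or> c j = 2 \<or> c j = 3" if "j \<in> {1..n}" for j
    using col_labels_mem[OF c that] by auto
  let ?X = "\<lambda>k l i j. Poly_Mapping.lookup (satp_point m n r c) (k, l, i, j)"
  have space: "satp_point m n r c \<in> satp_space m n"
    using row_labels_mem[OF r] col_labels_mem[OF c] by (auto simp: satp_space_def)
  have total: "(\<Sum>k=1..3. \<Sum>l=1..2. ?X k l i j) = 1" if "i \<in> {1..m}" "j \<in> {1..n}" for i j
    using that r'[OF that(1)] c'[OF that(2)] unfolding sum_1_3 sum_1_2 by auto
  \<comment> \<open>The values no longer mention \<open>j\<close> here, nor \<open>i\<close> in
    \<open>col\<close>, so the row and column equations become identities.\<close>
  have row: "?X 1 1 i j + ?X 2 1 i j + ?X 3 1 i j = of_bool (r i = 1)"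
    if "i \<in> {1..m}" "j \<in> {1..n}" for i j
    using that c'[OF that(2)] by auto
  have col: "?X k 1 i j + ?X k 2 i j = of_bool (k = c j)" if "i \<in> {1..m}" "j \<in> {1..n}" for i j k
    using that r'[OF that(1)] by auto
  have nonneg: "0 \<le> ?X k l i j" for k l i j
    by simp
  show ?thesis
    unfolding satp_system_def Let_def
    by (intro CollectI conjI ballI) (simp_all only: space total row col nonneg)
qed

text \<open>In each cell, nonnegative integers with sum 1 form a unit vector. The row equations make
  its label \<open>l\<close> constant along rows, the column equations make its label
  \<open>k\<close> constant along columns.\<close>

lemma integral_point_is_satp_point:
  assumes "1 \<le> m" "1 \<le> n" and x: "x \<in> satp_system m n" and int: "\<And>a. Poly_Mapping.lookup x a \<in> \<int>"
  shows "x \<in> satp_points m n"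
proof -
  define X where "X k l i j = Poly_Mapping.lookup x (k, l, i, j)" for k l i j
  \<comment> \<open>In cell \<open>(i, j)\<close>, \<open>R\<close> is the mass with
    \<open>l = 1\<close> and \<open>C k\<close> is the mass with first label
    \<open>k\<close>.\<close>
  define R where "R i j = X 1 1 i j + X 2 1 i j + X 3 1 i j" for i j
  define C where "C k i j = X k 1 i j + X k 2 i j" for k i j
  have sys: "x \<in> satp_space m n"
    "\<forall>i\<in>{1..m}. \<forall>j\<in>{1..n}. (\<Sum>k=1..3. \<Sum>l=1..2. X k l i j) = 1"
    "\<forall>i\<in>{1..m}. \<forall>j\<in>{1..n}. \<forall>t\<in>{1..n}. R i j = R i t"
    "\<forall>k\<in>{1..3}. \<forall>i\<in>{1..m}. \<forall>s\<in>{1..m}. \<forall>j\<in>{1..n}. C k i j = C k s j"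
    "\<forall>k\<in>{1..3}. \<forall>l\<in>{1..2}. \<forall>i\<in>{1..m}. \<forall>j\<in>{1..n}. 0 \<le> X k l i j"
    using x unfolding satp_system_def Let_def mem_Collect_eq X_def R_def C_def by - (elim conjE, assumption)+
  have keys: "Poly_Mapping.keys x \<subseteq> {1..3} \<times> {1..2} \<times> {1..m} \<times> {1..n}"
    using sys(1) unfolding satp_space_def by blast
  have total: "X 1 1 i j + X 1 2 i j + (X 2 1 i j + X 2 2 i j) + (X 3 1 i j + X 3 2 i j) = 1"
    if "i \<in> {1..m}" "j \<in> {1..n}" for i j
    using sys(2) that unfolding sum_1_3 sum_1_2 by blast
  note R = sys(3)[rule_format] and C = sys(4)[rule_format] and nonneg = sys(5)[rule_format]
  have X01: "X k l i j = 0 \<or> X k l i j = 1"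
    if kl: "k \<in> {1..3}" "l \<in> {1..2}" and ij: "i \<in> {1..m}" "j \<in> {1..n}" for k l i j
  proof -
    have "X k l i j \<le> 1"
      using total[OF ij] nonneg[OF _ _ ij] kl
      unfolding atLeastAtMost_1_3 atLeastAtMost_1_2 by (auto; smt (verit))
    moreover obtain z where "X k l i j = of_int z"
      using int[of "(k, l, i, j)"] by (auto simp: X_def elim: Ints_cases)
    ultimately show ?thesis
      using nonneg[OF kl ij] by auto
  qed
  \<comment> \<open>The row labels are read off in column 1 and the column labels in row 1; the last
    label is the one left over.\<close>
  define r where "r = restrict (\<lambda>i. if R i 1 = 1 then 1 else 2::nat) {1..m}"
  define c where "c = restrict (\<lambda>j. if C 1 1 j = 1 then 1 else if C 2 1 j = 1 then 2 else 3::nat) {1..n}"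
  have X: "X k l i j = of_bool (k = c j \<and> l = r i)"
    if kl: "k \<in> {1..3}" "l \<in> {1..2}" and ij: "i \<in> {1..m}" "j \<in> {1..n}" for k l i j
  proof -
    have rc: "r i = (if R i j = 1 then 1 else 2)"
      "c j = (if C 1 i j = 1 then 1 else if C 2 i j = 1 then 2 else 3)"
      using ij assms(1,2) R[of i j 1] C[of 1 i 1 j] C[of 2 i 1 j] by (auto simp: r_def c_def)
    have 1: "X 1 1 i j = 0 \<or> X 1 1 i j = 1" "X 1 2 i j = 0 \<or> X 1 2 i j = 1"
      "X 2 1 i j = 0 \<or> X 2 1 i j = 1" "X 2 2 i j = 0 \<or> X 2 2 i j = 1"
      "X 3 1 i j = 0 \<or> X 3 1 i j = 1" "X 3 2 i j = 0 \<or> X 3 2 i j = 1"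
      using X01[OF _ _ ij] by auto
    have "(k = 1 \<or> k = 2 \<or> k = 3) \<and> (l = 1 \<or> l = 2)"
      using kl by auto
    then show ?thesis
      using 1 total[OF ij] unfolding rc R_def C_def by (elim disjE conjE) simp_all
  qed
  have "x = satp_point m n r c"
  proof (rule poly_mapping_eqI)
    fix a :: "nat \<times> nat \<times> nat \<times> nat"
    obtain k l i j where a: "a = (k, l, i, j)"
      by (rule prod_cases4[of a])
    \<comment> \<open>Since the labels are in range, the entries of \<open>satp_point\<close> vanish
      outside the index box, as those of \<open>x\<close> do.\<close>
    have rc: "r i \<in> {1..2}" "c j \<in> {1..3}" if "i \<in> {1..m}" "j \<in> {1..n}"
      using that by (auto simp: r_def c_def)
    show "Poly_Mapping.lookup x a = Poly_Mapping.lookup (satp_point m n r c) a"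
    proof (cases "k \<in> {1..3} \<and> l \<in> {1..2} \<and> i \<in> {1..m} \<and> j \<in> {1..n}")
      case True
      then show ?thesis
        using X[of k l i j] unfolding a X_def by simp
    next
      case False
      then have "a \<notin> Poly_Mapping.keys x"
        using keys unfolding a by auto
      then show ?thesis
        using False rc unfolding a by (auto simp: in_keys_iff)
    qed
  qed
  moreover have "r \<in> row_labels m" "c \<in> col_labels n"
    by (auto simp: row_labels_def col_labels_def r_def c_def)
  ultimately show ?thesis
    by (simp add: satp_pointsI)
qed

lemma SATP_eq:
  assumes "1 \<le> m" "1 \<le> n"
  shows "SATP m n = convex hull satp_points m n"
proof -
  have "{x \<in> satp_system m n. \<forall>a. Poly_Mapping.lookup x a \<in> \<int>} = satp_points m n"
    using integral_point_is_satp_point[OF assms]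
    by (auto elim!: satp_pointsE simp: satp_point_in_system)
  then show ?thesis
    by (simp add: SATP_def)
qed

lemma satp_points_01: "v \<in> satp_points m n \<Longrightarrow> Poly_Mapping.lookup v a \<in> {0, 1}"
  by (cases a) (auto elim!: satp_pointsE)

lemma satp_face:
  "convex hull {v \<in> satp_points m n. Poly_Mapping.keys v \<subseteq> J} face_of convex hull satp_points m n"
proof (rule support_face)
  show "finite ({1..3::nat} \<times> {1..2::nat} \<times> {1..m} \<times> {1..n})"
    by simp
  show "Poly_Mapping.keys v \<subseteq> {1..3} \<times> {1..2} \<times> {1..m} \<times> {1..n}" if "v \<in> satp_points m n" for v
  proof -
    have "v \<in> satp_system m n"
      using that satp_point_in_system by (auto elim!: satp_pointsE)
    then show ?thesis
      by (simp add: satp_system_def satp_space_def)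
  qed
  show "0 \<le> Poly_Mapping.lookup v a" if "v \<in> satp_points m n" for v a
    using satp_points_01[OF that, of a] by auto
qed

text \<open>In each cell the new point has to use the entry of one of the two given points; a priori
  the choice may vary from cell to cell.\<close>

lemma keys_satp_point_subset_iff:
  "Poly_Mapping.keys (satp_point m n s d)
      \<subseteq> Poly_Mapping.keys (satp_point m n r c) \<union> Poly_Mapping.keys (satp_point m n r' c')
    \<longleftrightarrow> (\<forall>i\<in>{1..m}. \<forall>j\<in>{1..n}. (d j = c j \<and> s i = r i) \<or> (d j = c' j \<and> s i = r' i))"
  by (fastforce simp: subset_iff)

text \<open>No other labelled point is supported in the support of \<open>v\<close>, so the support
  face is \<open>{v}\<close>.\<close>

lemma skeleton_verts_SATP:
  assumes mn: "1 \<le> m" "1 \<le> n"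
  shows "skeleton_verts (SATP m n) = satp_points m n"
proof -
  have "v extreme_point_of (convex hull satp_points m n)" if v: "v \<in> satp_points m n" for v
  proof -
    obtain r c where rc: "r \<in> row_labels m" "c \<in> col_labels n" "v = satp_point m n r c"
      using v by (rule satp_pointsE)
    have "w = v" if w: "w \<in> satp_points m n" "Poly_Mapping.keys w \<subseteq> Poly_Mapping.keys v" for w
    proof -
      obtain s d where sd: "s \<in> row_labels m" "d \<in> col_labels n" "w = satp_point m n s d"
        using w(1) by (rule satp_pointsE)
      \<comment> \<open>Both given points are taken to be \<open>(r, c)\<close>, so the union is a
        single support.\<close>
      have *: "d j = c j \<and> s i = r i" if "i \<in> {1..m}" "j \<in> {1..n}" for i j
        using keys_satp_point_subset_iff[of m n s d r c r c] w(2) that unfolding sd(3) rc(3) by auto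
      have "s = r" "d = c"
        using *[of _ 1] *[of 1] mn
        by (auto intro!: row_labels_eqI[OF sd(1) rc(1)] col_labels_eqI[OF sd(2) rc(2)])
      then show ?thesis
        by (simp add: sd(3) rc(3))
    qed
    then have "{w \<in> satp_points m n. Poly_Mapping.keys w \<subseteq> Poly_Mapping.keys v} = {v}"
      using that by auto
    then have "{v} face_of convex hull satp_points m n"
      using satp_face[of m n "Poly_Mapping.keys v"] by simp
    then show ?thesis
      by (simp add: face_of_singleton)
  qed
  then show ?thesis
    by (auto simp: skeleton_verts_def SATP_eq[OF mn] dest: extreme_point_of_convex_hull)
qed

section \<open>Adjacency of labelled vertices\<close>

lemma satp_edgeI:
  assumes mn: "1 \<le> m" "1 \<le> n"
    and rc: "r \<in> row_labels m" "c \<in> col_labels n" "r' \<in> row_labels m" "c' \<in> col_labels n"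
    and neq: "r \<noteq> r' \<or> c \<noteq> c'"
    and between: "\<And>s d. s \<in> row_labels m \<Longrightarrow> d \<in> col_labels n \<Longrightarrow>
      \<forall>i\<in>{1..m}. \<forall>j\<in>{1..n}. (d j = c j \<and> s i = r i) \<or> (d j = c' j \<and> s i = r' i) \<Longrightarrow>
      (s = r \<and> d = c) \<or> (s = r' \<and> d = c')"
  shows "{satp_point m n r c, satp_point m n r' c'} \<in> skeleton_edges (SATP m n)"
proof (rule skeleton_edgesI)
  let ?u = "satp_point m n r c" and ?v = "satp_point m n r' c'"
  show "?u \<noteq> ?v"
    using neq satp_point_eq_iff[OF mn rc(1,3,2,4)] by simp
  have uv: "?u \<in> satp_points m n" "?v \<in> satp_points m n"
    using rc by (simp_all add: satp_pointsI)
  then show "?u \<in> skeleton_verts (SATP m n)" "?v \<in> skeleton_verts (SATP m n)"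
    by (simp_all add: skeleton_verts_SATP[OF mn])
  let ?K = "Poly_Mapping.keys ?u \<union> Poly_Mapping.keys ?v"
  \<comment> \<open>By \<open>between\<close>, the face of points supported in \<open>?K\<close> has
    only these two vertices.\<close>
  have "w = ?u \<or> w = ?v" if w: "w \<in> satp_points m n" "Poly_Mapping.keys w \<subseteq> ?K" for w
    using w(1)
  proof (rule satp_pointsE)
    fix s d
    assume sd: "s \<in> row_labels m" "d \<in> col_labels n" "w = satp_point m n s d"
    then show ?thesis
      using between[OF sd(1,2)] w(2) unfolding sd(3) keys_satp_point_subset_iff by blast
  qed
  then have "{w \<in> satp_points m n. Poly_Mapping.keys w \<subseteq> ?K} = {?u, ?v}"
    using uv by blast
  then show "convex hull {?u, ?v} face_of SATP m n"
    using satp_face[of m n ?K]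
    by (simp add: SATP_eq[OF mn])
qed

text \<open>
  If the labels differ in some row \<open>i\<close> and some column \<open>j\<close>, then the entry at \<open>(i, j)\<close> decides
  between the two points, and row \<open>i\<close> and column \<open>j\<close> propagate this decision to all labels.
\<close>

lemma satp_edge:
  assumes mn: "1 \<le> m" "1 \<le> n"
    and rc: "r \<in> row_labels m" "c \<in> col_labels n" "r' \<in> row_labels m" "c' \<in> col_labels n"
    and neq: "r \<noteq> r'" "c \<noteq> c'"
  shows "{satp_point m n r c, satp_point m n r' c'} \<in> skeleton_edges (SATP m n)"
proof (rule satp_edgeI[OF mn rc])
  obtain i where i: "i \<in> {1..m}" "r i \<noteq> r' i"
    using neq(1) row_labels_eqI[OF rc(1,3)] by blast
  obtain j where j: "j \<in> {1..n}" "c j \<noteq> c' j"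
    using neq(2) col_labels_eqI[OF rc(2,4)] by blast
  fix s d
  assume sd: "s \<in> row_labels m" "d \<in> col_labels n"
    and *: "\<forall>i\<in>{1..m}. \<forall>j\<in>{1..n}. (d j = c j \<and> s i = r i) \<or> (d j = c' j \<and> s i = r' i)"
  consider "d j = c j" "s i = r i" | "d j = c' j" "s i = r' i"
    using * i(1) j(1) by blast
  then show "(s = r \<and> d = c) \<or> (s = r' \<and> d = c')"
  proof cases
    case 1
    have "s = r"
      by (rule row_labels_eqI[OF sd(1) rc(1)]) (use * 1 j in metis)
    moreover have "d = c"
      by (rule col_labels_eqI[OF sd(2) rc(2)]) (use * 1 i in metis)
    ultimately show ?thesis
      by simp
  next
    case 2
    have "s = r'"
      by (rule row_labels_eqI[OF sd(1) rc(3)]) (use * 2 j in metis)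
    moreover have "d = c'"
      by (rule col_labels_eqI[OF sd(2) rc(4)]) (use * 2 i in metis)
    ultimately show ?thesis
      by simp
  qed
qed (use neq in simp)

text \<open>With one row, \<open>s 1\<close> is \<open>r 1\<close> or \<open>r' 1\<close>, which
  leaves nothing to mix. This serves the case where no third row labelling exists for a common
  neighbour.\<close>

lemma satp_edge_single_row:
  assumes n: "1 \<le> n" and rc: "r \<in> row_labels 1" "r' \<in> row_labels 1" "c \<in> col_labels n" and neq: "r \<noteq> r'"
  shows "{satp_point 1 n r c, satp_point 1 n r' c} \<in> skeleton_edges (SATP 1 n)"
proof (rule satp_edgeI[OF order_refl n rc(1,3,2,3)])
  fix s d
  assume sd: "s \<in> row_labels 1" "d \<in> col_labels n"
    and *: "\<forall>i\<in>{1..1}. \<forall>j\<in>{1..n}. (d j = c j \<and> s i = r i) \<or> (d j = c j \<and> s i = r' i)"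
  have "d = c"
    by (rule col_labels_eqI[OF sd(2) rc(3)]) (use * in auto)
  moreover have "s 1 = r 1 \<or> s 1 = r' 1"
    using * n by auto
  then have "s = r \<or> s = r'"
    using row_labels_eqI[OF sd(1) rc(1)] row_labels_eqI[OF sd(1) rc(2)] by auto
  ultimately show "(s = r \<and> d = c) \<or> (s = r' \<and> d = c)"
    by auto
qed (use neq in simp)

section \<open>Diameter\<close>

lemma finite_labels: "finite (row_labels m)" "finite (col_labels n)"
  by (auto simp: row_labels_def col_labels_def intro: finite_PiE)

lemma card_labels: "card (row_labels m) = 2 ^ m" "card (col_labels n) = 3 ^ n"
  by (simp_all add: row_labels_def col_labels_def card_PiE)

lemma ex_not_in_small_set:
  assumes "finite B" "card B < card A"
  obtains a where "a \<in> A" "a \<notin> B"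
  using assms by (metis card_mono not_le subsetI)

lemma graph_distance_SATP_le:
  assumes mn: "1 \<le> m" "1 \<le> n" and uv: "u \<in> satp_points m n" "v \<in> satp_points m n"
  shows "graph_distance (skeleton_edges (SATP m n)) u v \<le> 2"
proof -
  let ?E = "skeleton_edges (SATP m n)"
  let ?R = "{(a, b). {a, b} \<in> ?E}"
  obtain r c r' c' where rc: "r \<in> row_labels m" "c \<in> col_labels n" "r' \<in> row_labels m" "c' \<in> col_labels n"
    and u: "u = satp_point m n r c" and v: "v = satp_point m n r' c'"
    using uv by (elim satp_pointsE)
  show ?thesis
  proof (cases "m = 1 \<and> r \<noteq> r'")
    case True
    have "{u, v} \<in> ?E"
      using True satp_edge_single_row[OF mn(2)] satp_edge[OF mn rc] rc
      unfolding u v by (cases "c = c'") auto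
    then have "graph_distance ?E u v \<le> enat 1"
      by (intro graph_distance_le) simp
    also have "\<dots> \<le> 2"
      by (simp add: numeral_eq_enat)
    finally show ?thesis .
  next
    case False
    \<comment> \<open>For \<open>m = 1\<close> the two labellings coincide and 1 < 2; otherwise
      there are at least four labellings, so at most two can be avoided.\<close>
    have "card {r, r'} < card (row_labels m)"
    proof (cases "m = 1")
      case True
      then show ?thesis
        using False by (simp add: card_labels)
    next
      case False
      have "(2::nat) ^ 2 \<le> 2 ^ m"
        using False mn by (intro power_increasing) auto
      then show ?thesis
        unfolding card_labels by (simp add: card_insert_if)
    qed
    then obtain s where s: "s \<in> row_labels m" "s \<noteq> r" "s \<noteq> r'"
      by (rule ex_not_in_small_set[rotated]) auto
    have "(3::nat) ^ 1 \<le> 3 ^ n"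
      using mn by (intro power_increasing) auto
    then have "card {c, c'} < card (col_labels n)"
      unfolding card_labels by (simp add: card_insert_if)
    then obtain d where d: "d \<in> col_labels n" "d \<noteq> c" "d \<noteq> c'"
      by (rule ex_not_in_small_set[rotated]) auto
    have path: "(u, satp_point m n s d) \<in> ?R" "(satp_point m n s d, v) \<in> ?R"
      unfolding u v using s d rc by (auto intro!: satp_edge[OF mn])
    \<comment> \<open>If \<open>u = v\<close>, this walk goes out and back, and the bound still
      holds.\<close>
    have "(u, v) \<in> ?R ^^ Suc (Suc 0)"
      by (rule relpow_Suc_I[OF relpow_Suc_I[OF relpow_0_I path(1)] path(2)])
    then show ?thesis
      using graph_distance_le[where E = ?E and n = "Suc (Suc 0)"] by (simp add: numeral_eq_enat numeral_2_eq_2)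
  qed
qed

text \<open>For \<open>m = n = 1\<close> the polytope is a simplex with six pairwise adjacent
  vertices. Otherwise two rows or two columns allow a swap of a single label that preserves the sum
  of the two points.\<close>

lemma SATP_not_edge:
  assumes mn: "1 \<le> m" "1 \<le> n" "(m, n) \<noteq> (1, 1)"
  obtains u v where "u \<in> satp_points m n" "v \<in> satp_points m n" "u \<noteq> v"
    "{u, v} \<notin> skeleton_edges (SATP m n)"
proof -
  define r1 where "r1 = restrict (\<lambda>_. 1::nat) {1..m}"
  define r2 where "r2 = restrict (\<lambda>_. 2::nat) {1..m}"
  define c1 where "c1 = restrict (\<lambda>_. 1::nat) {1..n}"
  define c2 where "c2 = restrict (\<lambda>_. 2::nat) {1..n}"
  have L: "r1 \<in> row_labels m" "r2 \<in> row_labels m" "c1 \<in> col_labels n" "c2 \<in> col_labels n"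
    by (auto simp: row_labels_def col_labels_def r1_def r2_def c1_def c2_def)
  \<comment> \<open>Equality of the sums is checked cell by cell; outside the grid all entries are
    0.\<close>
  have swap: "satp_point m n r c + satp_point m n r' c' = satp_point m n s d + satp_point m n s' d'"
    if "\<And>i j k l. i \<in> {1..m} \<Longrightarrow> j \<in> {1..n} \<Longrightarrow>
      of_bool (k = c j \<and> l = r i) + of_bool (k = c' j \<and> l = r' i)
      = (of_bool (k = d j \<and> l = s i) + of_bool (k = d' j \<and> l = s' i) :: real)"
    for r r' s s' c c' d d'
  proof (rule poly_mapping_eqI)
    fix a :: "nat \<times> nat \<times> nat \<times> nat"
    obtain k l i j where "a = (k, l, i, j)"
      by (rule prod_cases4[of a])
    then show "Poly_Mapping.lookup (satp_point m n r c + satp_point m n r' c') a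
        = Poly_Mapping.lookup (satp_point m n s d + satp_point m n s' d') a"
      using that[of i j k l] by (cases "i \<in> {1..m} \<and> j \<in> {1..n}") (auto simp: lookup_add)
  qed
  have not_edge: "\<exists>u v. u \<in> satp_points m n \<and> v \<in> satp_points m n \<and> u \<noteq> v \<and>
      {u, v} \<notin> skeleton_edges (SATP m n)"
    if rows: "r \<in> row_labels m" "r' \<in> row_labels m" "s \<in> row_labels m" "s' \<in> row_labels m"
      and cols: "c \<in> col_labels n" "c' \<in> col_labels n" "d \<in> col_labels n" "d' \<in> col_labels n"
      and neq: "r \<noteq> r' \<or> c \<noteq> c'" "s \<noteq> r \<or> d \<noteq> c" "s \<noteq> r' \<or> d \<noteq> c'"
      and sum: "satp_point m n r c + satp_point m n r' c' = satp_point m n s d + satp_point m n s' d'"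
    for r r' s s' c c' d d'
  proof (intro exI conjI)
    note points = satp_pointsI[OF rows(1) cols(1)] satp_pointsI[OF rows(2) cols(2)]
      satp_pointsI[OF rows(3) cols(3)] satp_pointsI[OF rows(4) cols(4)]
    show "satp_point m n r c \<in> satp_points m n" "satp_point m n r' c' \<in> satp_points m n"
      by (fact points)+
    have distinct: "satp_point m n r c \<noteq> satp_point m n r' c'"
      "satp_point m n s d \<noteq> satp_point m n r c" "satp_point m n s d \<noteq> satp_point m n r' c'"
      using neq satp_point_eq_iff[OF mn(1,2) rows(1,2) cols(1,2)]
        satp_point_eq_iff[OF mn(1,2) rows(3,1) cols(3,1)]
        satp_point_eq_iff[OF mn(1,2) rows(3,2) cols(3,2)] by blast+
    then show "satp_point m n r c \<noteq> satp_point m n r' c'"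
      by blast
    show "{satp_point m n r c, satp_point m n r' c'} \<notin> skeleton_edges (SATP m n)"
      unfolding SATP_eq[OF mn(1,2)]
      using satp_points_01 points distinct sum by (rule not_skeleton_edge)
  qed
  consider "2 \<le> m" | "2 \<le> n"
    using mn by force
  then have "\<exists>u v. u \<in> satp_points m n \<and> v \<in> satp_points m n \<and> u \<noteq> v \<and>
      {u, v} \<notin> skeleton_edges (SATP m n)"
  proof cases
    case 1
    \<comment> \<open>The constant labellings exchange their values in row 1. Row 1 then separates
      the new labelling from \<open>r1\<close>, and row 2, present as \<open>2 \<le> m\<close>,
      separates it from \<open>r2\<close>. The column case is analogous.\<close>
    have upd: "r1(1 := 2) \<in> row_labels m" "r2(1 := 1) \<in> row_labels m"
      using L mn by (auto simp: row_labels_def col_labels_def PiE_iff extensional_def)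
    have "r1 1 = 1" "r2 1 = 2" "r1 2 = 1" "r2 2 = 2"
      using 1 by (auto simp: r1_def r2_def)
    then have "r1 1 \<noteq> r2 1" "(r1(1 := 2)) 1 \<noteq> r1 1" "(r1(1 := 2)) 2 \<noteq> r2 2"
      by simp_all
    then have "r1 \<noteq> r2" "r1(1 := 2) \<noteq> r1" "r1(1 := 2) \<noteq> r2"
      by metis+
    then show ?thesis
      by (intro not_edge[OF L(1,2) upd L(3,3,3,3)])
        (auto intro!: swap simp: r1_def r2_def)
  next
    case 2
    have upd: "c1(1 := 2) \<in> col_labels n" "c2(1 := 1) \<in> col_labels n"
      using L mn by (auto simp: row_labels_def col_labels_def PiE_iff extensional_def)
    have "c1 1 = 1" "c2 1 = 2" "c1 2 = 1" "c2 2 = 2"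
      using 2 by (auto simp: c1_def c2_def)
    then have "c1 1 \<noteq> c2 1" "(c1(1 := 2)) 1 \<noteq> c1 1" "(c1(1 := 2)) 2 \<noteq> c2 2"
      by simp_all
    then have "c1 \<noteq> c2" "c1(1 := 2) \<noteq> c1" "c1(1 := 2) \<noteq> c2"
      by metis+
    then show ?thesis
      by (intro not_edge[OF L(1,1,1,1,3,4) upd])
        (auto intro!: swap simp: c1_def c2_def)
  qed
  then show thesis
    using that by blast
qed

lemma skeleton_diameter_SATP:
  assumes "1 \<le> m" "1 \<le> n" "(m, n) \<noteq> (1, 1)"
  shows "skeleton_diameter (SATP m n) = 2"
proof (rule antisym)
  show "skeleton_diameter (SATP m n) \<le> 2"
    unfolding skeleton_diameter_def graph_diameter_def skeleton_verts_SATP[OF assms(1,2)]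
    by (intro SUP_least graph_distance_SATP_le assms)
  obtain u v where uv: "u \<in> satp_points m n" "v \<in> satp_points m n"
    "u \<noteq> v" "{u, v} \<notin> skeleton_edges (SATP m n)"
    using SATP_not_edge[OF assms] .
  then have "2 \<le> graph_distance (skeleton_edges (SATP m n)) u v"
    by (intro graph_distance_ge_2)
  also have "\<dots> \<le> skeleton_diameter (SATP m n)"
    unfolding skeleton_diameter_def graph_diameter_def skeleton_verts_SATP[OF assms(1,2)]
    by (intro SUP_upper2[OF uv(1)] SUP_upper uv(2))
  finally show "2 \<le> skeleton_diameter (SATP m n)" .
qed

section \<open>Clique number\<close>

lemma skeleton_clique_number_SATP_ge:
  assumes mn: "1 \<le> m" "1 \<le> n"
  shows "2 ^ min m n \<le> skeleton_clique_number (SATP m n)"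
proof -
  let ?N = "2 ^ min m n :: nat"
  have "?N \<le> 2 ^ m"
    by (intro power_increasing) auto
  then obtain f where f: "f ` {..<?N} \<subseteq> row_labels m" "inj_on f {..<?N}"
    using card_le_inj[of "{..<?N}" "row_labels m"] finite_labels unfolding card_labels by auto
  have "?N \<le> 2 ^ n"
    by (intro power_increasing) auto
  also have "(2::nat) ^ n \<le> 3 ^ n"
    by (intro power_mono) auto
  finally obtain g where g: "g ` {..<?N} \<subseteq> col_labels n" "inj_on g {..<?N}"
    using card_le_inj[of "{..<?N}" "col_labels n"] finite_labels unfolding card_labels by auto
  \<comment> \<open>As \<open>f\<close> and \<open>g\<close> are both injective, distinct indices
    give points differing in rows and in columns, so \<open>satp_edge\<close> applies to every
    pair.\<close>
  define h where "h q = satp_point m n (f q) (g q)" for q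
  have "inj_on h {..<?N}"
    using f g by (auto simp: inj_on_def h_def satp_point_eq_iff[OF mn] image_subset_iff)
  then have "card (h ` {..<?N}) = ?N"
    by (simp add: card_image)
  moreover have "h ` {..<?N} \<subseteq> satp_points m n"
    using f(1) g(1) by (auto simp: h_def image_subset_iff intro!: satp_pointsI)
  moreover have "clique (h ` {..<?N}) (skeleton_edges (SATP m n))"
    using f g
    by (auto simp: clique_def h_def image_subset_iff inj_on_def intro!: satp_edge[OF mn])
  moreover have fin: "finite (satp_points m n)"
    by (rule finite_subset[of _ "case_prod (satp_point m n) ` (row_labels m \<times> col_labels n)"])
      (auto elim!: satp_pointsE simp: finite_labels)
  \<comment> \<open>\<open>Max\<close> needs a finite set: clique sizes are cardinalities of subsets
    of a finite vertex set.\<close>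
  have "finite {card K | K. K \<subseteq> satp_points m n \<and> finite K \<and> clique K (skeleton_edges (SATP m n))}"
    by (rule finite_subset[of _ "card ` Pow (satp_points m n)"]) (auto simp: fin)
  ultimately show ?thesis
    unfolding skeleton_clique_number_def clique_number_def skeleton_verts_SATP[OF mn]
    by (intro Max_ge) (auto intro!: exI[of _ "h ` {..<?N}"])
qed

section \<open>Dimension bound and superpolynomial growth\<close>

lemma affine_dimension_SATP_le: "affine_dimension (SATP m n) \<le> 6 * m * n"
proof -
  let ?I = "{1..3::nat} \<times> {1..2::nat} \<times> {1..m} \<times> {1..n}"
  let ?B = "(\<lambda>a. Poly_Mapping.single a (1::real)) ` ?I"
  have "satp_space m n \<subseteq> span ?B"
  proof
    fix x assume "x \<in> satp_space m n"
    then have keys: "Poly_Mapping.keys x \<subseteq> ?I"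
      by (simp add: satp_space_def)
    have "x = (\<Sum>a\<in>?I. Poly_Mapping.lookup x a *\<^sub>R Poly_Mapping.single a 1)"
    proof (rule poly_mapping_eqI)
      fix b
      have "(\<Sum>a\<in>?I. Poly_Mapping.lookup x a * (1 when a = b))
          = (\<Sum>a\<in>?I. if a = b then Poly_Mapping.lookup x a else 0)"
        by (rule sum.cong) (auto simp: when_def)
      also have "\<dots> = Poly_Mapping.lookup x b"
        using keys by (subst sum.delta) (auto simp: in_keys_iff)
      finally show "Poly_Mapping.lookup x b
          = Poly_Mapping.lookup (\<Sum>a\<in>?I. Poly_Mapping.lookup x a *\<^sub>R Poly_Mapping.single a 1) b"
        by (simp add: lookup_sum lookup_single)
    qed
    also have "\<dots> \<in> span ?B"
      by (intro span_sum span_scale span_base imageI)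
    finally show "x \<in> span ?B" .
  qed
  then have "SATP m n \<subseteq> span ?B"
    unfolding SATP_def
    by (intro hull_minimal subspace_imp_convex subspace_span) (auto simp: satp_system_def)
  then have "{x - y | x y. x \<in> SATP m n \<and> y \<in> SATP m n} \<subseteq> span ?B"
    by (auto intro: span_diff)
  then have "affine_dimension (SATP m n) \<le> card ?B"
    unfolding affine_dimension_def by (rule dim_le_card) simp
  also have "\<dots> \<le> card ?I"
    by (rule card_image_le) simp
  finally show ?thesis
    by (simp add: card_cartesian_product)
qed

text \<open>For \<open>k = min m n\<close>, the dimension is at most
  \<open>6 * m * n = 6 * k * max m n \<le> 6 * k ^ Suc r\<close>, polynomial in \<open>k\<close>,
  while there are cliques of size \<open>2 ^ k\<close>.\<close>

lemma superpolynomial_clique_number_SATP: "superpolynomial_clique_number SATP"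
  unfolding superpolynomial_clique_number_def
proof (intro allI)
  fix p :: "real poly" and r :: nat
  let ?C = "\<Sum>i\<le>degree p. \<bar>coeff p i\<bar>"
  obtain N where N: "?C * (1 + 6 * real k ^ Suc r) ^ degree p < 2 ^ k" if "N \<le> k" for k
    using eventually_poly_less_exp[of ?C "Suc r" "degree p"] by (auto simp: eventually_sequentially)
  have "poly p (real (affine_dimension (SATP m n))) < real (skeleton_clique_number (SATP m n))"
    \<comment> \<open>The threshold \<open>max 1 N\<close> also ensures \<open>m, n \<ge> 1\<close>,
      as the clique bound requires.\<close>
    if N': "max 1 N \<le> min m n" and le: "max m n \<le> min m n ^ r" for m n
  proof -
    let ?k = "min m n" and ?d = "affine_dimension (SATP m n)"
    have "m * n = ?k * max m n"
      by (auto simp: min_def max_def)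
    also have "\<dots> \<le> ?k ^ Suc r"
      using le by simp
    finally have "?d \<le> 6 * ?k ^ Suc r"
      using affine_dimension_SATP_le[of m n] by simp
    then have "real ?d \<le> 6 * real ?k ^ Suc r"
      by (metis of_nat_le_iff of_nat_mult of_nat_numeral of_nat_power)
    then have "?C * (1 + real ?d) ^ degree p \<le> ?C * (1 + 6 * real ?k ^ Suc r) ^ degree p"
      by (intro mult_left_mono power_mono sum_nonneg) auto
    also have "\<dots> < 2 ^ ?k"
      using N' by (intro N) simp
    also have "\<dots> \<le> real (skeleton_clique_number (SATP m n))"
      using skeleton_clique_number_SATP_ge[of m n] N'
      by (metis max.bounded_iff min.bounded_iff numeral_power_le_of_nat_cancel_iff)
    finally show ?thesis
      using poly_le_const_times_power[of "real ?d" p] by simp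
  qed
  then show "\<exists>N. \<forall>m n. N \<le> min m n \<and> max m n \<le> min m n ^ r \<longrightarrow>
      poly p (real (affine_dimension (SATP m n))) < real (skeleton_clique_number (SATP m n))"
    by blast
qed

theorem corollary15:
  shows "(\<forall>m n. 1 \<le> m \<and> 1 \<le> n \<and> (m, n) \<noteq> (1, 1) \<longrightarrow> skeleton_diameter (SATP m n) = 2) \<and>
    superpolynomial_clique_number SATP \<and>
    (\<forall>m n. 1 \<le> m \<and> 1 \<le> n \<longrightarrow> 2 ^ min m n \<le> skeleton_clique_number (SATP m n))"
  using skeleton_diameter_SATP superpolynomial_clique_number_SATP skeleton_clique_number_SATP_ge
  by blast

end
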